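(* Let $n\ge 3$. The complex $C_\bullet(S_n)$ is generated in dimension $3n-4$, as a cell complex, by exactly those codimension one cells of $P_n$ that are of the form $e(\sigma_x,\sigma_y,\sigma_z;\tau_c)$, where $\sigma_x,\sigma_y,\sigma_z\in\Sigma_{n-1}$, $c\in\{x,y,z\}$, and $\tau_c$ is a transposition appearing in $\sigma_c$ which produces an intersection for $e(\sigma_x,\sigma_y,\sigma_z)$. That is, a codimension one cell of $P_n$ consists of singular plumbers' curves if and only if it is of this form.
   Context: Plumbers' curves. Let $v=(v_1,\dots,v_{n-1})\in((0,1)^3)^{n-1}$. Write $v_i=(v_i^x,v_i^y,v_i^z)$, and by convention $v_0=(0,0,0)$, $v_n=(1,1,1)$. For $0\le i\le n-1$ define three (possibly degenerate) straight segments, called pipes: $\mathbf x_i$ from $(v_i^x,v_i^y,v_i^z)$ to $(v_{i+1}^x,v_i^y,v_i^z)$; $\mathbf y_i$ from $(v_{i+1}^x,v_i^y,v_i^z)$ to $(v_{i+1}^x,v_{i+1}^y,v_i^z)$; $\mathbf z_i$ from $(v_{i+1}^x,v_{i+1}^y,v_i^z)$ to $(v_{i+1}^x,v_{i+1}^y,v_{i+1}^z)$. The $n$-move plumbers' curve $\phi_v$ is the piecewise linear path traversing the pipes linearly in the order $\mathbf x_0,\mathbf y_0,\mathbf z_0,\mathbf x_1,\dots,\mathbf z_{n-1}$. The space $P_n$ of all $\phi_v$ is identified (and topologized) with $((0,1)^3)^{n-1}$ via $v$. Two pipes are distant if, in this ordered sequence, they are separated by at least three intervening pipes. The curve $\phi_v$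 is singular if the images of some pair of its distant pipes intersect. $S_n\subseteq P_n$ is the subspace of singular curves. Cells. For $\sigma_x,\sigma_y,\sigma_z\in\Sigma_{n-1}$ (symmetric group), $e(\sigma_x,\sigma_y,\sigma_z)\subset P_n$ is the set of $\phi_v$ with $0<v^c_{\sigma_c(1)}<\cdots<v^c_{\sigma_c(n-1)}<1$ for each $c\in\{x,y,z\}$; these top-dimensional cells have dimension $3n-3$. A transposition $\tau$ appears in $\sigma\in\Sigma_{n-1}$ if $\tau=(\sigma(i)\ \sigma(i+1))$ for some $i\in\{1,\dots,n-2\}$. If $\tau_c=(\sigma_c(i)\ \sigma_c(i+1))$ appears in $\sigma_c$, the codimension one cell $e(\sigma_x,\sigma_y,\sigma_z;\tau_c)$ is defined by the same conditions as $e(\sigma_x,\sigma_y,\sigma_z)$ except that $v^c_{\sigma_c(i)}<v^c_{\sigma_c(i+1)}$ is replaced by $v^c_{\sigma_c(i)}=v^c_{\sigma_c(i+1)}$. Cells of higher codimension are obtained by replacing several such inequalities by equalities. $C_\bullet(S_n)$ is the cell complex on $S_n$ induced by (i.e. consisting of the cells in the closures of) all codimension one cells of $P_n$ whose elements are singular plumbers' curves. Producing an intersection. Set $\sigma^{-1}(0)=0$ and $\sigma^{-1}(n)=n$ for $\sigma\in\Sigma_{n-1}$; "between" means strictly between (in either order). A transposition $(a\ b)$ appearing in $\sigma_c$ produces an intersection for $e(\sigma_x,\sigma_y,\sigma_z)$ if the following condition holds for the ordered pair $(p,q)=(a,b)$ or for $(p,q)=(b,a)$: - if $c=x$: $\sigma_y^{-1}(q)$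 is between $\sigma_y^{-1}(p-1)$ and $\sigma_y^{-1}(p)$, and $\sigma_z^{-1}(p-1)$ is between $\sigma_z^{-1}(q-1)$ and $\sigma_z^{-1}(q)$; - if $c=y$: $\sigma_x^{-1}(q)$ is between $\sigma_x^{-1}(p)$ and $\sigma_x^{-1}(p+1)$, and $\sigma_z^{-1}(p)$ is between $\sigma_z^{-1}(q-1)$ and $\sigma_z^{-1}(q)$; - if $c=z$: $\sigma_x^{-1}(q+1)$ is between $\sigma_x^{-1}(p)$ and $\sigma_x^{-1}(p+1)$, and $\sigma_y^{-1}(p)$ is between $\sigma_y^{-1}(q)$ and $\sigma_y^{-1}(q+1)$. *)

theory Defs
  imports "HOL-Analysis.Analysis" "HOL-Combinatorics.Permutations"
begin

section \<open>Plumbers' curves\<close>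

text \<open>
  A curve \<open>\<phi>\<^sub>v\<close> is represented by its parameter \<open>v = (v\<^sub>1, \<dots>, v\<^bsub>n-1\<^esub>)\<close>, an extensional function on
  \<open>{1..<n}\<close>; lemma \<open>inj_on_plumbers_curve\<close> below justifies this. The coordinates \<open>x\<close>, \<open>y\<close>, \<open>z\<close>
  are the components \<open>1\<close>, \<open>2\<close>, \<open>3\<close> of \<open>real ^ 3\<close>.
\<close>

definition plumbers_space :: "nat \<Rightarrow> (nat \<Rightarrow> real ^ 3) set" where
  "plumbers_space n = {1..<n} \<rightarrow>\<^sub>E box 0 1"

definition plumbers_topology :: "nat \<Rightarrow> (nat \<Rightarrow> real ^ 3) topology" where
  "plumbers_topology n = product_topology (\<lambda>_. top_of_set (box 0 1)) {1..<n}"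

lemma topspace_plumbers_topology: "topspace (plumbers_topology n) = plumbers_space n"
  by (simp add: plumbers_topology_def plumbers_space_def)

text \<open>The points \<open>v\<^sub>0, \<dots>, v\<^sub>n\<close>; note that \<open>1 :: real ^ 3\<close> is the vector \<open>(1, 1, 1)\<close>.\<close>

definition vertex :: "nat \<Rightarrow> (nat \<Rightarrow> real ^ 3) \<Rightarrow> nat \<Rightarrow> real ^ 3" where
  "vertex n v i = (if i = 0 then 0 else if i = n then 1 else v i)"

definition x_pipe :: "nat \<Rightarrow> (nat \<Rightarrow> real ^ 3) \<Rightarrow> nat \<Rightarrow> real \<Rightarrow> real ^ 3" where
  "x_pipe n v i = linepath
     (vector [vertex n v i $ 1, vertex n v i $ 2, vertex n v i $ 3])
     (vector [vertex n v (i + 1) $ 1, vertex n v i $ 2, vertex n v i $ 3])"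

definition y_pipe :: "nat \<Rightarrow> (nat \<Rightarrow> real ^ 3) \<Rightarrow> nat \<Rightarrow> real \<Rightarrow> real ^ 3" where
  "y_pipe n v i = linepath
     (vector [vertex n v (i + 1) $ 1, vertex n v i $ 2, vertex n v i $ 3])
     (vector [vertex n v (i + 1) $ 1, vertex n v (i + 1) $ 2, vertex n v i $ 3])"

definition z_pipe :: "nat \<Rightarrow> (nat \<Rightarrow> real ^ 3) \<Rightarrow> nat \<Rightarrow> real \<Rightarrow> real ^ 3" where
  "z_pipe n v i = linepath
     (vector [vertex n v (i + 1) $ 1, vertex n v (i + 1) $ 2, vertex n v i $ 3])
     (vector [vertex n v (i + 1) $ 1, vertex n v (i + 1) $ 2, vertex n v (i + 1) $ 3])"

text \<open>The \<open>k\<close>-th pipe (\<open>k < 3 * n\<close>) in the order \<open>x\<^sub>0, y\<^sub>0, z\<^sub>0, x\<^sub>1, \<dots>, z\<^bsub>n-1\<^esub>\<close>.\<close>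

definition pipe :: "nat \<Rightarrow> (nat \<Rightarrow> real ^ 3) \<Rightarrow> nat \<Rightarrow> real \<Rightarrow> real ^ 3" where
  "pipe n v k =
     (if k mod 3 = 0 then x_pipe n v (k div 3)
      else if k mod 3 = 1 then y_pipe n v (k div 3)
      else z_pipe n v (k div 3))"

text \<open>
  The curve \<open>\<phi>\<^sub>v\<close> on \<open>{0..1}\<close>, spending time \<open>1 / (3 * n)\<close> on each pipe. The minimum makes the time
  \<open>t = 1\<close> belong to the last pipe.
\<close>

definition plumbers_curve :: "nat \<Rightarrow> (nat \<Rightarrow> real ^ 3) \<Rightarrow> real \<Rightarrow> real ^ 3" where
  "plumbers_curve n v t =
     (let k = min (3 * n - 1) (nat \<lfloor>3 * real n * t\<rfloor>) in pipe n v k (3 * real n * t - real k))"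

text \<open>Three intervening pipes means that the positions differ by at least four.\<close>

definition distant :: "nat \<Rightarrow> nat \<Rightarrow> bool" where
  "distant k l \<longleftrightarrow> k + 3 < l \<or> l + 3 < k"

definition singular_curve :: "nat \<Rightarrow> (nat \<Rightarrow> real ^ 3) \<Rightarrow> bool" where
  "singular_curve n v \<longleftrightarrow>
     (\<exists>k<3 * n. \<exists>l<3 * n. distant k l \<and> path_image (pipe n v k) \<inter> path_image (pipe n v l) \<noteq> {})"

definition singular_space :: "nat \<Rightarrow> (nat \<Rightarrow> real ^ 3) set" where
  "singular_space n = {v \<in> plumbers_space n. singular_curve n v}"

lemma pipe_joins: "pipe n v k 1 = pipe n v (Suc k) 0"
proof -
  consider "k mod 3 = 0" | "k mod 3 = 1" | "k mod 3 = 2"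
    by linarith
  then show ?thesis
    by cases (auto simp: pipe_def x_pipe_def y_pipe_def z_pipe_def linepath_def mod_Suc div_Suc)
qed

lemma plumbers_curve_on_pipe:
  assumes k: "k < 3 * n"
    and t: "real k / (3 * real n) \<le> t" "t \<le> real (k + 1) / (3 * real n)"
  shows "plumbers_curve n v t = pipe n v k (3 * real n * t - real k)"
proof -
  have n: "0 < 3 * real n"
    using k by simp
  have lo: "real k \<le> 3 * real n * t" and hi: "3 * real n * t \<le> real k + 1"
    using t n by (simp_all add: field_simps)
  show ?thesis
  proof (cases "3 * real n * t = real k + 1")
    case True
    then have fl: "nat \<lfloor>3 * real n * t\<rfloor> = Suc k"
      by linarith
    show ?thesis
    proof (cases "Suc k < 3 * n")
      case less: True
      then have "min (3 * n - 1) (nat \<lfloor>3 * real n * t\<rfloor>) = Suc k"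
        using fl by linarith
      then show ?thesis
        using True pipe_joins[of n v k] by (simp add: plumbers_curve_def)
    next
      case False
      then have "min (3 * n - 1) (nat \<lfloor>3 * real n * t\<rfloor>) = k"
        using fl k by linarith
      then show ?thesis
        by (simp add: plumbers_curve_def)
    qed
  next
    case False
    then have "nat \<lfloor>3 * real n * t\<rfloor> = k"
      using lo hi by linarith
    then have "min (3 * n - 1) (nat \<lfloor>3 * real n * t\<rfloor>) = k"
      using k by linarith
    then show ?thesis
      by (simp add: plumbers_curve_def)
  qed
qed

lemma plumbers_curve_image_pipe:
  assumes k: "k < 3 * n"
  shows "plumbers_curve n v ` {real k / (3 * real n)..real (k + 1) / (3 * real n)}
    = path_image (pipe n v k)" (is "_ ` ?I = _")
proof -
  have n: "0 < 3 * real n"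
    using k by simp
  have "(\<lambda>t. 3 * real n * t - real k) ` ?I = {0..1}"
  proof (intro equalityI subsetI)
    fix s assume "s \<in> (\<lambda>t. 3 * real n * t - real k) ` ?I"
    then show "s \<in> {0..1}"
      using n by (auto simp: field_simps)
  next
    fix s :: real assume s: "s \<in> {0..1}"
    have "s = 3 * real n * ((s + real k) / (3 * real n)) - real k"
      using n by simp
    moreover have "(s + real k) / (3 * real n) \<in> ?I"
      using s n by (auto intro!: divide_right_mono)
    ultimately show "s \<in> (\<lambda>t. 3 * real n * t - real k) ` ?I"
      by blast
  qed
  moreover have "plumbers_curve n v ` ?I = pipe n v k ` ((\<lambda>t. 3 * real n * t - real k) ` ?I)"
    unfolding image_image using plumbers_curve_on_pipe[OF k] by (intro image_cong) auto
  ultimately show ?thesis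
    by (simp add: path_image_def)
qed

lemma inj_on_plumbers_curve: "inj_on (plumbers_curve n) (plumbers_space n)"
proof (rule inj_onI)
  fix v w assume v: "v \<in> plumbers_space n" and w: "w \<in> plumbers_space n"
    and eq: "plumbers_curve n v = plumbers_curve n w"
  have at: "plumbers_curve n u (real (3 * i) / (3 * real n)) = u i" if i: "i \<in> {1..<n}" for u i
  proof -
    have "plumbers_curve n u (real (3 * i) / (3 * real n))
        = pipe n u (3 * i) (3 * real n * (real (3 * i) / (3 * real n)) - real (3 * i))"
      using i by (intro plumbers_curve_on_pipe) (auto simp: field_simps)
    also have "\<dots> = pipe n u (3 * i) 0"
      using i by simp
    also have "\<dots> = u i"
      using i by (simp add: pipe_def x_pipe_def linepath_def vertex_def vec_eq_iff forall_3 vector_3)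
    finally show ?thesis .
  qed
  have "v i = w i" if "i \<in> {1..<n}" for i
    using at[OF that, of v] at[OF that, of w] eq by simp
  then show "v = w"
    using v w unfolding plumbers_space_def by (intro PiE_ext)
qed


section \<open>Cells\<close>

text \<open>
  A family \<open>\<sigma>\<close> collects \<open>\<sigma>\<^sub>x = \<sigma> 1\<close>, \<open>\<sigma>\<^sub>y = \<sigma> 2\<close>, \<open>\<sigma>\<^sub>z = \<sigma> 3\<close>. In \<open>cell n \<sigma> E\<close> the set \<open>E c\<close> records the
  positions \<open>i\<close> at which the inequality between the \<open>c\<close>-coordinates number \<open>\<sigma> c i\<close> and
  \<open>\<sigma> c (i + 1)\<close> is replaced by an equality. The outer inequalities \<open>0 < _\<close> and \<open>_ < 1\<close>
  are part of membership in \<open>plumbers_space n\<close>.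
\<close>

definition perm_family :: "nat \<Rightarrow> (3 \<Rightarrow> nat \<Rightarrow> nat) \<Rightarrow> bool" where
  "perm_family n \<sigma> \<longleftrightarrow> (\<forall>c. \<sigma> c permutes {1..<n})"

definition cell :: "nat \<Rightarrow> (3 \<Rightarrow> nat \<Rightarrow> nat) \<Rightarrow> (3 \<Rightarrow> nat set) \<Rightarrow> (nat \<Rightarrow> real ^ 3) set" where
  "cell n \<sigma> E = {v \<in> plumbers_space n. \<forall>c. \<forall>i\<in>{1..n - 2}.
     if i \<in> E c then v (\<sigma> c i) $ c = v (\<sigma> c (i + 1)) $ c
     else v (\<sigma> c i) $ c < v (\<sigma> c (i + 1)) $ c}"

definition cells_of_codim :: "nat \<Rightarrow> nat \<Rightarrow> (nat \<Rightarrow> real ^ 3) set set" where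
  "cells_of_codim n k =
     {cell n \<sigma> E | \<sigma> E. perm_family n \<sigma> \<and> (\<forall>c. E c \<subseteq> {1..n - 2}) \<and> (\<Sum>c\<in>UNIV. card (E c)) = k}"

definition cells :: "nat \<Rightarrow> (nat \<Rightarrow> real ^ 3) set set" where
  "cells n = (\<Union>k. cells_of_codim n k)"

definition cells_of_dim :: "nat \<Rightarrow> nat \<Rightarrow> (nat \<Rightarrow> real ^ 3) set set" where
  "cells_of_dim n d = \<Union> {cells_of_codim n k | k. d + k = 3 * n - 3}"

definition appears :: "nat \<Rightarrow> (nat \<Rightarrow> nat) \<Rightarrow> (nat \<Rightarrow> nat) \<Rightarrow> bool" where
  "appears n \<tau> s \<longleftrightarrow> (\<exists>i\<in>{1..n - 2}. \<tau> = Transposition.transpose (s i) (s (i + 1)))"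

text \<open>
  The cell \<open>e(\<sigma>\<^sub>x, \<sigma>\<^sub>y, \<sigma>\<^sub>z; \<tau>\<^sub>c)\<close>. If \<open>\<tau>\<close> appears in \<open>\<sigma> c\<close>, the set of positions below is the singleton
  of the unique \<open>i\<close> with \<open>\<tau> = (\<sigma> c i  \<sigma> c (i + 1))\<close>.
\<close>

definition codim_one_cell ::
    "nat \<Rightarrow> (3 \<Rightarrow> nat \<Rightarrow> nat) \<Rightarrow> 3 \<Rightarrow> (nat \<Rightarrow> nat) \<Rightarrow> (nat \<Rightarrow> real ^ 3) set" where
  "codim_one_cell n \<sigma> c \<tau> = cell n \<sigma> (\<lambda>d.
     if d = c then {i \<in> {1..n - 2}. \<tau> = Transposition.transpose (\<sigma> c i) (\<sigma> c (i + 1))} else {})"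

definition generated_complex ::
    "nat \<Rightarrow> (nat \<Rightarrow> real ^ 3) set set \<Rightarrow> (nat \<Rightarrow> real ^ 3) set set" where
  "generated_complex n G = {e \<in> cells n. \<exists>g\<in>G. e \<subseteq> plumbers_topology n closure_of g}"

definition singular_complex :: "nat \<Rightarrow> (nat \<Rightarrow> real ^ 3) set set" where
  "singular_complex n = generated_complex n {e \<in> cells_of_codim n 1. e \<subseteq> singular_space n}"


section \<open>Transpositions producing an intersection\<close>

definition strictly_between :: "nat \<Rightarrow> nat \<Rightarrow> nat \<Rightarrow> bool" where
  "strictly_between m a b \<longleftrightarrow> a < m \<and> m < b \<or> b < m \<and> m < a"

text \<open>
  As \<open>\<sigma> c permutes {1..<n}\<close> fixes every number outside \<open>{1..<n}\<close>, the conventions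
  \<open>inv (\<sigma> c) 0 = 0\<close> and \<open>inv (\<sigma> c) n = n\<close> hold automatically.
\<close>

definition intersection_condition :: "(3 \<Rightarrow> nat \<Rightarrow> nat) \<Rightarrow> 3 \<Rightarrow> nat \<Rightarrow> nat \<Rightarrow> bool" where
  "intersection_condition \<sigma> c p q \<longleftrightarrow>
     (let ix = inv (\<sigma> 1); iy = inv (\<sigma> 2); iz = inv (\<sigma> 3) in
      if c = 1 then
        strictly_between (iy q) (iy (p - 1)) (iy p) \<and>
        strictly_between (iz (p - 1)) (iz (q - 1)) (iz q)
      else if c = 2 then
        strictly_between (ix q) (ix p) (ix (p + 1)) \<and>
        strictly_between (iz p) (iz (q - 1)) (iz q)
      else
        strictly_between (ix (q + 1)) (ix p) (ix (p + 1)) \<and>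
        strictly_between (iy p) (iy q) (iy (q + 1)))"

definition produces_intersection :: "(3 \<Rightarrow> nat \<Rightarrow> nat) \<Rightarrow> 3 \<Rightarrow> (nat \<Rightarrow> nat) \<Rightarrow> bool" where
  "produces_intersection \<sigma> c \<tau> \<longleftrightarrow>
     (\<exists>a b. a \<noteq> b \<and> \<tau> = Transposition.transpose a b \<and>
       (intersection_condition \<sigma> c a b \<or> intersection_condition \<sigma> c b a))"

definition intersection_cells :: "nat \<Rightarrow> (nat \<Rightarrow> real ^ 3) set set" where
  "intersection_cells n = {codim_one_cell n \<sigma> c \<tau> | \<sigma> c \<tau>.
     perm_family n \<sigma> \<and> appears n \<tau> (\<sigma> c) \<and> produces_intersection \<sigma> c \<tau>}"

end

theory Submission imports Defs begin

text \<open>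
  On a codimension one cell the coordinates of the vertices \<open>v\<^sub>0, \<dots>, v\<^sub>n\<close> along each axis have a fixed
  linear order, except that along one axis \<open>c\<close> exactly one pair of interior vertices \<open>a, b\<close> shares its
  coordinate. Two pipes lie on axis-parallel lines. Two different parallel pipes can only
  meet if vertices agree along two axes, which a single coincidence does not allow. If two pipes with different directions
  meet, then their coordinates agree along the third axis \<open>e\<close>, and along each of the other two
  axes the fixed coordinate of one pipe lies in the interval spanned by the other. For distant pipes
  the agreement along \<open>e\<close> concerns two different vertices, so that \<open>e = c\<close> and these vertices are
  \<open>a\<close> and \<open>b\<close>; the two interval conditions concern the axes without a coincidence, so they
  depend only on the order of the vertices there and become betweenness conditions on the inverse
  permutations. The pairs (y, z), (x, z), (x, y) of directions give the three cases
  \<open>c = x, y, z\<close> of \<open>intersection_condition\<close>; conversely, strict betweenness forces the pipes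
  to be distant. Hence singularity is constant on each codimension one cell
  (\<open>singular_curve_on_wall_iff\<close>), and since cells are nonempty this decides which of them
  consist of singular curves.

  It remains to see that passing to the generated complex adds no further cell of codimension one.
  In the closure of a cell all inequalities hold weakly and all equalities persist. A point of
  another codimension one cell has no coincidence to spare, so that it satisfies the inequalities
  strictly and lies in the first cell (\<open>in_wall_if_in_closure_of_wall\<close>); cells with a common point
  are equal (\<open>cells_meeting_equal\<close>).
\<close>

section \<open>The order of the coordinates on a cell\<close>

lemma cell_subset: "cell n \<sigma> E \<subseteq> plumbers_space n"
  by (auto simp: cell_def)

lemma vertex_bounds:
  assumes "v \<in> plumbers_space n" "a \<in> {1..<n}"
  shows "0 < vertex n v a $ c" "vertex n v a $ c < 1"
  using assms by (auto simp: plumbers_space_def vertex_def mem_box_cart dest!: PiE_mem)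

lemma permutes_index_le:
  fixes n :: nat
  assumes "\<sigma> permutes {1..<n}" "a \<le> n"
  shows "\<sigma> a \<le> n"
proof (cases "a \<in> {1..<n}")
  case True
  then show ?thesis
    using permutes_in_image[OF assms(1), of a] by simp
next
  case False
  then show ?thesis
    using permutes_not_in[OF assms(1), of a] assms(2) by simp
qed

text \<open>
  The end points \<open>v\<^sub>0\<close> and \<open>v\<^sub>n\<close> are included by treating \<open>0\<close> and \<open>n\<close> as the first and last positions of
  \<open>\<sigma> c\<close>, which fixes them; the outer inequalities \<open>0 < _ < 1\<close> are then steps like all others.
\<close>

lemma cell_step:
  assumes v: "v \<in> cell n \<sigma> E" and s: "\<sigma> c permutes {1..<n}" and E: "E c \<subseteq> {1..n - 2}"
    and i: "i < n"
  shows "if i \<in> E c then vertex n v (\<sigma> c i) $ c = vertex n v (\<sigma> c (Suc i)) $ c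
    else vertex n v (\<sigma> c i) $ c < vertex n v (\<sigma> c (Suc i)) $ c"
proof -
  have P: "v \<in> plumbers_space n"
    using v cell_subset by blast
  have in_iff: "\<sigma> c k \<in> {1..<n} \<longleftrightarrow> k \<in> {1..<n}" for k
    by (rule permutes_in_image[OF s])
  have fix0: "\<sigma> c 0 = 0" and fixn: "\<sigma> c n = n"
    using permutes_not_in[OF s] by auto
  consider "i \<in> {1..n - 2}" | "i = 0" | "i \<noteq> 0" "Suc i = n"
    using i by force
  then show ?thesis
  proof cases
    case 1
    then have "\<sigma> c i \<in> {1..<n}" "\<sigma> c (Suc i) \<in> {1..<n}"
      unfolding in_iff using i by auto
    then have "vertex n v (\<sigma> c i) = v (\<sigma> c i)" "vertex n v (\<sigma> c (Suc i)) = v (\<sigma> c (Suc i))"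
      by (auto simp: vertex_def)
    moreover have "if i \<in> E c then v (\<sigma> c i) $ c = v (\<sigma> c (i + 1)) $ c
        else v (\<sigma> c i) $ c < v (\<sigma> c (i + 1)) $ c"
      using v 1 unfolding cell_def by blast
    ultimately show ?thesis
      by (simp split: if_splits)
  next
    case 2
    then have "i \<notin> E c"
      using E by auto
    moreover have "0 < vertex n v (\<sigma> c 1) $ c"
    proof (cases "n = 1")
      case True
      then show ?thesis
        using fixn by (simp add: vertex_def)
    next
      case False
      then show ?thesis
        using i in_iff[of 1] by (intro vertex_bounds[OF P]) auto
    qed
    ultimately show ?thesis
      using 2 fix0 by (simp add: vertex_def)
  next
    case 3
    then have "i \<notin> E c"
      using E by auto
    moreover have "vertex n v (\<sigma> c i) $ c < 1"
      using 3 i in_iff[of i] by (intro vertex_bounds[OF P]) auto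
    ultimately show ?thesis
      using 3 fixn by (simp add: vertex_def)
  qed
qed

text \<open>
  Along the positions the coordinate increases weakly, and it is constant precisely on the runs of
  positions in \<open>E c\<close>.
\<close>

lemma cell_less_iff:
  assumes v: "v \<in> cell n \<sigma> E" and s: "\<sigma> c permutes {1..<n}" and E: "E c \<subseteq> {1..n - 2}"
    and ij: "i \<le> n" "j \<le> n"
  shows "vertex n v (\<sigma> c i) $ c < vertex n v (\<sigma> c j) $ c \<longleftrightarrow> \<not> {i..<j} \<subseteq> E c"
proof -
  let ?f = "\<lambda>i. vertex n v (\<sigma> c i) $ c"
  note step = cell_step[of v n \<sigma> E c, OF v s E]
  have mono: "?f i \<le> ?f j" if "i \<le> j" "j \<le> n" for i j
    using that
  proof (induction j rule: dec_induct)
    case (step k)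
    then show ?case
      using cell_step[of v n \<sigma> E c k, OF v s E] by (auto split: if_splits)
  qed simp
  have eq: "?f i = ?f j" if "i \<le> j" "j \<le> n" "{i..<j} \<subseteq> E c" for i j
    using that
  proof (induction j rule: dec_induct)
    case (step k)
    then have "?f i = ?f k"
      by (simp add: atLeastLessThanSuc)
    moreover from step have "k \<in> E c" "k < n"
      by auto
    ultimately show ?case
      using cell_step[of v n \<sigma> E c k, OF v s E] by simp
  qed simp
  show ?thesis
  proof
    assume less: "?f i < ?f j"
    then have "i < j"
      using mono[of j i] ij by linarith
    then show "\<not> {i..<j} \<subseteq> E c"
      using eq[of i j] ij less by auto
  next
    assume "\<not> {i..<j} \<subseteq> E c"
    then obtain k where "i \<le> k" "k < j" "k \<notin> E c"
      by (meson atLeastLessThan_iff subsetI)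
    then show "?f i < ?f j"
      using mono[of i k] step[of k] mono[of "Suc k" j] ij by auto
  qed
qed

lemma cell_vertex_less_iff:
  assumes v: "v \<in> cell n \<sigma> E" and s: "\<sigma> c permutes {1..<n}" and E: "E c \<subseteq> {1..n - 2}"
    and ab: "a \<le> n" "b \<le> n"
  shows "vertex n v a $ c < vertex n v b $ c \<longleftrightarrow> \<not> {inv (\<sigma> c) a..<inv (\<sigma> c) b} \<subseteq> E c"
  using cell_less_iff[of v n \<sigma> E c "inv (\<sigma> c) a" "inv (\<sigma> c) b", OF v s E] ab
    permutes_index_le[OF permutes_inv[OF s]] by (simp add: permutes_inverses[OF s])

text \<open>
  A cell is the set of all curves with the same coordinatewise order type as any one of its points,
  so the cells partition the space although different pairs \<open>(\<sigma>, E)\<close> may describe the same cell.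
\<close>

lemma cells_meeting_equal:
  assumes v: "v \<in> cell n \<sigma> E" "v \<in> cell n \<sigma>' E'"
    and s: "perm_family n \<sigma>" "perm_family n \<sigma>'"
    and E: "\<And>c. E c \<subseteq> {1..n - 2}" "\<And>c. E' c \<subseteq> {1..n - 2}"
  shows "cell n \<sigma> E = cell n \<sigma>' E'"
proof -
  let ?T = "{w \<in> plumbers_space n. \<forall>c. \<forall>a\<in>{1..<n}. \<forall>b\<in>{1..<n}. w a $ c < w b $ c \<longleftrightarrow> v a $ c < v b $ c}"
  have T: "cell n \<rho> F = ?T"
    if v: "v \<in> cell n \<rho> F" and r: "perm_family n \<rho>" and F: "\<And>c. F c \<subseteq> {1..n - 2}" for \<rho> F
  proof (intro equalityI subsetI)
    fix w assume w: "w \<in> cell n \<rho> F"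
    have "w a $ c < w b $ c \<longleftrightarrow> v a $ c < v b $ c" if "a \<in> {1..<n}" "b \<in> {1..<n}" for a b c
    proof -
      have "vertex n w a $ c < vertex n w b $ c \<longleftrightarrow> vertex n v a $ c < vertex n v b $ c"
        using that cell_vertex_less_iff[of _ n \<rho> F c a b] v w F r
        by (simp add: perm_family_def)
      then show ?thesis
        using that by (simp add: vertex_def)
    qed
    then show "w \<in> ?T"
      using w cell_subset by blast
  next
    fix w assume w: "w \<in> ?T"
    have "if i \<in> F c then w (\<rho> c i) $ c = w (\<rho> c (i + 1)) $ c
      else w (\<rho> c i) $ c < w (\<rho> c (i + 1)) $ c" if i: "i \<in> {1..n - 2}" for c i
    proof -
      have "\<rho> c permutes {1..<n}"
        using r by (simp add: perm_family_def)
      then have "\<rho> c i \<in> {1..<n}" "\<rho> c (i + 1) \<in> {1..<n}"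
        unfolding permutes_in_image[OF \<open>\<rho> c permutes {1..<n}\<close>] using i by auto
      then have "w (\<rho> c i) $ c < w (\<rho> c (i + 1)) $ c \<longleftrightarrow> v (\<rho> c i) $ c < v (\<rho> c (i + 1)) $ c"
        "w (\<rho> c (i + 1)) $ c < w (\<rho> c i) $ c \<longleftrightarrow> v (\<rho> c (i + 1)) $ c < v (\<rho> c i) $ c"
        using w by blast+
      moreover have "if i \<in> F c then v (\<rho> c i) $ c = v (\<rho> c (i + 1)) $ c
        else v (\<rho> c i) $ c < v (\<rho> c (i + 1)) $ c"
        using v i unfolding cell_def by blast
      ultimately show ?thesis
        by (smt (verit))
    qed
    then show "w \<in> cell n \<rho> F"
      using w unfolding cell_def by blast
  qed
  show ?thesis
    using T[OF v(1) s(1) E(1)] T[OF v(2) s(2) E(2)] by simp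
qed

lemma cell_nonempty:
  assumes s: "perm_family n \<sigma>"
  shows "cell n \<sigma> E \<noteq> {}"
proof -
  \<comment> \<open>\<open>h c i\<close> counts the strict inequalities before position \<open>i\<close>; scaling puts these levels into the
    open unit interval.\<close>
  define h where "h c i = card ({1..<i} - E c)" for c i
  define v :: "nat \<Rightarrow> real ^ 3" where "v = (\<lambda>a\<in>{1..<n}. \<chi> c. (1 + real (h c (inv (\<sigma> c) a))) / (n + 1))"
  have perm: "\<sigma> c permutes {1..<n}" for c
    using s by (simp add: perm_family_def)
  have h: "h c i < n" if "i < n" for c i
  proof -
    have "h c i \<le> card {1..<i}"
      unfolding h_def by (intro card_mono) auto
    then show ?thesis
      using that by simp
  qed
  have "v \<in> plumbers_space n"
  proof -
    have "inv (\<sigma> c) a < n" if "a \<in> {1..<n}" for a c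
      using permutes_in_image[OF permutes_inv[OF perm[of c]], of a] that by simp
    then show ?thesis
      using h by (auto simp: plumbers_space_def v_def mem_box_cart field_simps add_pos_nonneg)
  qed
  moreover have "if i \<in> E c then v (\<sigma> c i) $ c = v (\<sigma> c (i + 1)) $ c
      else v (\<sigma> c i) $ c < v (\<sigma> c (i + 1)) $ c" if i: "i \<in> {1..n - 2}" for c i
  proof -
    have "\<sigma> c i \<in> {1..<n}" "\<sigma> c (i + 1) \<in> {1..<n}"
      unfolding permutes_in_image[OF perm[of c]] using i by auto
    moreover have "h c (i + 1) = (if i \<in> E c then h c i else Suc (h c i))"
    proof -
      have "{1..<i + 1} = insert i {1..<i}"
        using i by auto
      then show ?thesis
        by (simp add: h_def insert_Diff_if)
    qed
    ultimately show ?thesis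
      by (simp add: v_def permutes_inverses[OF perm] divide_strict_right_mono)
  qed
  ultimately have "v \<in> cell n \<sigma> E"
    unfolding cell_def by blast
  then show ?thesis
    by blast
qed


section \<open>Codimension one cells\<close>

abbreviation wall :: "nat \<Rightarrow> (3 \<Rightarrow> nat \<Rightarrow> nat) \<Rightarrow> 3 \<Rightarrow> nat \<Rightarrow> (nat \<Rightarrow> real ^ 3) set" where
  "wall n \<sigma> c i \<equiv> cell n \<sigma> (\<lambda>d. if d = c then {i} else {})"

lemma transpose_eq_iff_doubleton:
  assumes "a \<noteq> b"
  shows "Transposition.transpose a b = Transposition.transpose p q \<longleftrightarrow> {a, b} = {p, q}"
  using assms by (auto simp: doubleton_eq_iff fun_eq_iff Transposition.transpose_def)

lemma permuted_pair_eq_iff: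
  assumes "s permutes S"
  shows "{s k, s (Suc k)} = {s i, s (Suc i)} \<longleftrightarrow> k = i"
  using permutes_inj[OF assms] by (auto simp: doubleton_eq_iff inj_eq)

lemma codim_one_cell_eq_wall:
  assumes s: "\<sigma> c permutes {1..<n}" and i: "i \<in> {1..n - 2}"
  shows "codim_one_cell n \<sigma> c (Transposition.transpose (\<sigma> c i) (\<sigma> c (i + 1))) = wall n \<sigma> c i"
proof -
  have "\<sigma> c i \<noteq> \<sigma> c (i + 1)"
    using permutes_inj[OF s] by (simp add: inj_eq)
  then have "{k \<in> {1..n - 2}. Transposition.transpose (\<sigma> c i) (\<sigma> c (i + 1))
      = Transposition.transpose (\<sigma> c k) (\<sigma> c (k + 1))} = {i}"
    using i permuted_pair_eq_iff[OF s, of i] by (auto simp: transpose_eq_iff_doubleton)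
  then show ?thesis
    unfolding codim_one_cell_def by (simp only:)
qed

lemma cells_of_codim_one:
  "cells_of_codim n 1 = {wall n \<sigma> c i | \<sigma> c i. perm_family n \<sigma> \<and> i \<in> {1..n - 2}}"
proof (intro equalityI subsetI)
  fix e assume "e \<in> cells_of_codim n 1"
  then obtain \<sigma> E where e: "e = cell n \<sigma> E" "perm_family n \<sigma>" and E: "\<And>c. E c \<subseteq> {1..n - 2}"
    and "(\<Sum>c\<in>UNIV. card (E c)) = 1"
    unfolding cells_of_codim_def by blast
  then obtain c where c: "card (E c) = 1" "\<And>d. d \<noteq> c \<Longrightarrow> card (E d) = 0"
    using sum_eq_1_iff[of UNIV "\<lambda>c. card (E c)"] by auto
  then obtain i where i: "E c = {i}"
    by (auto simp: card_1_singleton_iff)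
  have "E d = {}" if "d \<noteq> c" for d
    using c(2)[OF that] E[of d] finite_subset by fastforce
  then have "E = (\<lambda>d. if d = c then {i} else {})"
    using i by (intro ext) auto
  then show "e \<in> {wall n \<sigma> c i | \<sigma> c i. perm_family n \<sigma> \<and> i \<in> {1..n - 2}}"
    using e i E[of c] by blast
next
  fix e assume "e \<in> {wall n \<sigma> c i | \<sigma> c i. perm_family n \<sigma> \<and> i \<in> {1..n - 2}}"
  then obtain \<sigma> c i where e: "e = wall n \<sigma> c i" "perm_family n \<sigma>" "i \<in> {1..n - 2}"
    by blast
  moreover have "(\<Sum>d\<in>UNIV. card (if d = c then {i} else {})) = 1"
    by (simp add: if_distrib[of card] sum.delta cong: if_cong)
  ultimately show "e \<in> cells_of_codim n 1"
    unfolding cells_of_codim_def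
    by (intro CollectI exI[of _ \<sigma>] exI[of _ "\<lambda>d. if d = c then {i} else {}"]) simp
qed

lemma atLeastLessThan_subset_singleton_iff:
  fixes k l i :: nat
  assumes "k < l"
  shows "{k..<l} \<subseteq> {i} \<longleftrightarrow> k = i \<and> l = Suc i"
proof
  assume "{k..<l} \<subseteq> {i}"
  moreover have "k \<in> {k..<l}" "l - 1 \<in> {k..<l}"
    using assms by auto
  ultimately have "k = i" "l - 1 = i"
    by blast+
  then show "k = i \<and> l = Suc i"
    using assms by auto
qed simp

text \<open>
  A codimension one cell admits exactly one coincidence of coordinates. Both the exclusion of
  parallel pipes and the rigidity of cells under closure rest on this count.
\<close>

lemma wall_vertex_eq_iff:
  assumes v: "v \<in> wall n \<sigma> c i" and s: "perm_family n \<sigma>" and i: "i \<in> {1..n - 2}"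
    and ab: "a \<le> n" "b \<le> n"
  shows "vertex n v a $ d = vertex n v b $ d \<longleftrightarrow>
    a = b \<or> d = c \<and> {a, b} = {\<sigma> c i, \<sigma> c (Suc i)}"
proof -
  let ?E = "\<lambda>d. if d = c then {i} else {}"
  have perm: "\<sigma> d permutes {1..<n}"
    using s by (simp add: perm_family_def)
  obtain k l where kl: "k = inv (\<sigma> d) a" "l = inv (\<sigma> d) b"
    by blast
  then have ab_eq: "a = \<sigma> d k" "b = \<sigma> d l"
    by (simp_all add: permutes_inverses[OF perm])
  have "vertex n v a $ d = vertex n v b $ d \<longleftrightarrow> {k..<l} \<subseteq> ?E d \<and> {l..<k} \<subseteq> ?E d"
  proof -
    have "?E d \<subseteq> {1..n - 2}"
      using i by simp
    note less_iff = cell_vertex_less_iff[of v n \<sigma> ?E d, OF v perm this]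
    have "vertex n v a $ d = vertex n v b $ d \<longleftrightarrow>
        \<not> vertex n v a $ d < vertex n v b $ d \<and> \<not> vertex n v b $ d < vertex n v a $ d"
      by linarith
    then show ?thesis
      by (simp only: less_iff[OF ab] less_iff[OF ab(2,1)] kl not_not)
  qed
  also have "\<dots> \<longleftrightarrow> k = l \<or> d = c \<and> (k = i \<and> l = Suc i \<or> k = Suc i \<and> l = i)"
  proof (cases k l rule: linorder_cases)
    case less
    then have "{k..<l} \<subseteq> {i} \<longleftrightarrow> k = i \<and> l = Suc i"
      by (rule atLeastLessThan_subset_singleton_iff)
    then show ?thesis
      using less by auto
  next
    case greater
    then have "{l..<k} \<subseteq> {i} \<longleftrightarrow> l = i \<and> k = Suc i"
      by (rule atLeastLessThan_subset_singleton_iff)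
    then show ?thesis
      using greater by auto
  qed simp
  also have "\<dots> \<longleftrightarrow> a = b \<or> d = c \<and> {a, b} = {\<sigma> c i, \<sigma> c (Suc i)}"
    using permutes_inj[OF perm] unfolding ab_eq by (auto simp: doubleton_eq_iff inj_eq)
  finally show ?thesis .
qed

text \<open>
  Along an axis without a coincidence different vertices have different coordinates, so a closed
  segment behaves like an open one and only the order of the vertices matters.
\<close>

lemma wall_segment_iff:
  assumes v: "v \<in> wall n \<sigma> c i" and s: "perm_family n \<sigma>" and "d \<noteq> c"
    and le: "m \<le> n" "a \<le> n" "b \<le> n" and ne: "m \<noteq> a" "m \<noteq> b"
  shows "vertex n v m $ d \<in> closed_segment (vertex n v a $ d) (vertex n v b $ d) \<longleftrightarrow>
    strictly_between (inv (\<sigma> d) m) (inv (\<sigma> d) a) (inv (\<sigma> d) b)"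
proof -
  have perm: "\<sigma> d permutes {1..<n}"
    using s by (simp add: perm_family_def)
  have less: "vertex n v p $ d < vertex n v q $ d \<longleftrightarrow> inv (\<sigma> d) p < inv (\<sigma> d) q"
    if "p \<le> n" "q \<le> n" for p q
    using cell_vertex_less_iff[of v n \<sigma> _ d p q, OF v perm] \<open>d \<noteq> c\<close> that by simp
  have "inv (\<sigma> d) m \<noteq> inv (\<sigma> d) a" "inv (\<sigma> d) m \<noteq> inv (\<sigma> d) b"
    using ne permutes_inj[OF permutes_inv[OF perm]] by (simp_all add: inj_eq)
  then show ?thesis
    using less[of m a] less[of a m] less[of m b] less[of b m] le
    by (auto simp: closed_segment_eq_real_ivl strictly_between_def)
qed


section \<open>Intersections of pipes\<close>

definition paths_meet :: "(real \<Rightarrow> 'a :: topological_space) \<Rightarrow> (real \<Rightarrow> 'a) \<Rightarrow> bool" where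
  "paths_meet g h \<longleftrightarrow> path_image g \<inter> path_image h \<noteq> {}"

lemma paths_meet_commute: "paths_meet g h \<longleftrightarrow> paths_meet h g"
  by (simp add: paths_meet_def Int_commute)

lemma mem_closed_segment_axis:
  fixes a b p :: "real ^ 'n"
  assumes "\<forall>d. d \<noteq> c \<longrightarrow> b $ d = a $ d"
  shows "p \<in> closed_segment a b \<longleftrightarrow> p $ c \<in> closed_segment (a $ c) (b $ c) \<and> (\<forall>d. d \<noteq> c \<longrightarrow> p $ d = a $ d)"
proof -
  have off: "((1 - u) *\<^sub>R a + u *\<^sub>R b) $ d = a $ d" if "d \<noteq> c" for u d
    using assms that by (simp add: algebra_simps)
  have "p = (1 - u) *\<^sub>R a + u *\<^sub>R b \<longleftrightarrow>
      p $ c = (1 - u) *\<^sub>R (a $ c) + u *\<^sub>R (b $ c) \<and> (\<forall>d. d \<noteq> c \<longrightarrow> p $ d = a $ d)"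
    (is "?eq \<longleftrightarrow> ?coords") for u
  proof
    show ?coords if ?eq
      using off[of _ u] by (simp add: that)
    assume coords: ?coords
    have "p $ d = ((1 - u) *\<^sub>R a + u *\<^sub>R b) $ d" for d
      using coords off[of d u] by (cases "d = c") simp_all
    then show ?eq
      unfolding vec_eq_iff by blast
  qed
  then show ?thesis
    unfolding in_segment by blast
qed

lemma mem_x_pipe:
  "p \<in> path_image (x_pipe n v i) \<longleftrightarrow>
    p $ 1 \<in> closed_segment (vertex n v i $ 1) (vertex n v (Suc i) $ 1) \<and>
    p $ 2 = vertex n v i $ 2 \<and> p $ 3 = vertex n v i $ 3"
  unfolding x_pipe_def path_image_linepath
  by (subst mem_closed_segment_axis[where c = 1]) (auto simp: forall_3)

lemma mem_y_pipe:
  "p \<in> path_image (y_pipe n v i) \<longleftrightarrow>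
    p $ 1 = vertex n v (Suc i) $ 1 \<and>
    p $ 2 \<in> closed_segment (vertex n v i $ 2) (vertex n v (Suc i) $ 2) \<and> p $ 3 = vertex n v i $ 3"
  unfolding y_pipe_def path_image_linepath
  by (subst mem_closed_segment_axis[where c = 2]) (auto simp: forall_3)

lemma mem_z_pipe:
  "p \<in> path_image (z_pipe n v i) \<longleftrightarrow>
    p $ 1 = vertex n v (Suc i) $ 1 \<and> p $ 2 = vertex n v (Suc i) $ 2 \<and>
    p $ 3 \<in> closed_segment (vertex n v i $ 3) (vertex n v (Suc i) $ 3)"
  unfolding z_pipe_def path_image_linepath
  by (subst mem_closed_segment_axis[where c = 3]) (auto simp: forall_3)

text \<open>
  The only possible common point of two pipes with different directions has, along the direction of
  each, the fixed coordinate of the other.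
\<close>

lemma x_pipe_meets_y_pipe:
  "paths_meet (x_pipe n v i) (y_pipe n v j) \<longleftrightarrow>
    vertex n v (Suc j) $ 1 \<in> closed_segment (vertex n v i $ 1) (vertex n v (Suc i) $ 1) \<and>
    vertex n v i $ 2 \<in> closed_segment (vertex n v j $ 2) (vertex n v (Suc j) $ 2) \<and>
    vertex n v i $ 3 = vertex n v j $ 3"
  unfolding paths_meet_def ex_in_conv[symmetric] Int_iff mem_x_pipe mem_y_pipe
  by (auto intro!: exI[of _ "vector [vertex n v (Suc j) $ 1, vertex n v i $ 2, vertex n v i $ 3]"])

lemma x_pipe_meets_z_pipe:
  "paths_meet (x_pipe n v i) (z_pipe n v j) \<longleftrightarrow>
    vertex n v (Suc j) $ 1 \<in> closed_segment (vertex n v i $ 1) (vertex n v (Suc i) $ 1) \<and>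
    vertex n v i $ 2 = vertex n v (Suc j) $ 2 \<and>
    vertex n v i $ 3 \<in> closed_segment (vertex n v j $ 3) (vertex n v (Suc j) $ 3)"
  unfolding paths_meet_def ex_in_conv[symmetric] Int_iff mem_x_pipe mem_z_pipe
  by (auto intro!: exI[of _ "vector [vertex n v (Suc j) $ 1, vertex n v i $ 2, vertex n v i $ 3]"])

lemma y_pipe_meets_z_pipe:
  "paths_meet (y_pipe n v i) (z_pipe n v j) \<longleftrightarrow>
    vertex n v (Suc i) $ 1 = vertex n v (Suc j) $ 1 \<and>
    vertex n v (Suc j) $ 2 \<in> closed_segment (vertex n v i $ 2) (vertex n v (Suc i) $ 2) \<and>
    vertex n v i $ 3 \<in> closed_segment (vertex n v j $ 3) (vertex n v (Suc j) $ 3)"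
  unfolding paths_meet_def ex_in_conv[symmetric] Int_iff mem_y_pipe mem_z_pipe
  by (auto intro!: exI[of _ "vector [vertex n v (Suc i) $ 1, vertex n v (Suc j) $ 2, vertex n v i $ 3]"])

lemma pipe_triple:
  "pipe n v (3 * i) = x_pipe n v i"
  "pipe n v (Suc (3 * i)) = y_pipe n v i"
  "pipe n v (Suc (Suc (3 * i))) = z_pipe n v i"
  by (simp_all add: pipe_def mod_Suc div_Suc)

lemma singular_curve_iff_paths_meet:
  "singular_curve n v \<longleftrightarrow> (\<exists>l<3 * n. \<exists>k. k + 3 < l \<and> paths_meet (pipe n v k) (pipe n v l))"
proof
  assume "singular_curve n v"
  then obtain k l where kl: "k < 3 * n" "l < 3 * n" and dist: "distant k l"
      and meet: "paths_meet (pipe n v k) (pipe n v l)"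
    unfolding singular_curve_def paths_meet_def by metis
  from dist have "k + 3 < l \<or> l + 3 < k"
    unfolding distant_def .
  then show "\<exists>l<3 * n. \<exists>k. k + 3 < l \<and> paths_meet (pipe n v k) (pipe n v l)"
  proof
    assume "k + 3 < l"
    then show ?thesis
      using kl(2) meet by (intro exI conjI)
  next
    assume "l + 3 < k"
    then show ?thesis
      using kl(1) meet[unfolded paths_meet_commute[of "pipe n v k"]] by (intro exI conjI)
  qed
next
  assume "\<exists>l<3 * n. \<exists>k. k + 3 < l \<and> paths_meet (pipe n v k) (pipe n v l)"
  then obtain k l where kl: "l < 3 * n" "k + 3 < l" "paths_meet (pipe n v k) (pipe n v l)"
    by blast
  then have "k < 3 * n" "distant k l"
    by (simp_all add: distant_def)
  then show "singular_curve n v"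
    using kl unfolding singular_curve_def paths_meet_def by blast
qed

text \<open>
  The hypothesis says that coincidences of vertex coordinates occur along at most one axis; it rules
  out parallel pipes, whose meeting needs coincidences along two axes. For a pair with different
  directions, let \<open>i\<close> be the index of the pipe whose direction comes first in the order x, y, z, and \<open>j\<close>
  that of the other; then distant means \<open>i \<noteq> j\<close> and \<open>i \<noteq> j + 1\<close>, whichever the two directions are.
\<close>

lemma singular_curve_iff_mixed_pipes_meet:
  assumes single: "\<And>c d a b a' b'. \<lbrakk>c \<noteq> d; a \<le> n; b \<le> n; a' \<le> n; b' \<le> n;
      vertex n v a $ c = vertex n v b $ c; vertex n v a' $ d = vertex n v b' $ d\<rbrakk> \<Longrightarrow> a = b \<or> a' = b'"
  shows "singular_curve n v \<longleftrightarrow> (\<exists>i<n. \<exists>j<n. i \<noteq> j \<and> i \<noteq> Suc j \<and>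
    (paths_meet (x_pipe n v i) (y_pipe n v j) \<or>
     paths_meet (x_pipe n v i) (z_pipe n v j) \<or>
     paths_meet (y_pipe n v i) (z_pipe n v j)))"
    (is "_ \<longleftrightarrow> (\<exists>i<n. \<exists>j<n. i \<noteq> j \<and> i \<noteq> Suc j \<and> ?M i j)")
proof
  assume "singular_curve n v"
  then obtain k l where kl: "l < 3 * n" "k + 3 < l" and meet: "paths_meet (pipe n v k) (pipe n v l)"
    unfolding singular_curve_iff_paths_meet by metis
  define i j where "i = k div 3" "j = l div 3"
  then have i: "k = 3 * i \<or> k = Suc (3 * i) \<or> k = Suc (Suc (3 * i))"
    and j: "l = 3 * j \<or> l = Suc (3 * j) \<or> l = Suc (Suc (3 * j))"
    by linarith+
  have ij: "i < j" "j < n"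
    using i j kl by linarith+
  have "\<not> paths_meet (x_pipe n v i) (x_pipe n v j)"
    using ij single[of 2 3 i j i j] by (auto simp: paths_meet_def mem_x_pipe)
  moreover have "\<not> paths_meet (y_pipe n v i) (y_pipe n v j)"
    using ij single[of 1 3 "Suc i" "Suc j" i j] by (auto simp: paths_meet_def mem_y_pipe)
  moreover have "\<not> paths_meet (z_pipe n v i) (z_pipe n v j)"
    using ij single[of 1 2 "Suc i" "Suc j" "Suc i" "Suc j"] by (auto simp: paths_meet_def mem_z_pipe)
  ultimately have "?M i j \<or> j \<noteq> Suc i \<and> ?M j i"
    using i j meet kl(2) by (elim disjE) (simp_all add: pipe_triple paths_meet_commute)
  then show "\<exists>i<n. \<exists>j<n. i \<noteq> j \<and> i \<noteq> Suc j \<and> ?M i j"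
  proof
    assume "?M i j"
    then show ?thesis
      using ij by (intro exI[of _ i] exI[of _ j] conjI) simp_all
  next
    assume "j \<noteq> Suc i \<and> ?M j i"
    then show ?thesis
      using ij by (intro exI[of _ i] exI[of _ j] conjI) simp_all
  qed
next
  assume "\<exists>i<n. \<exists>j<n. i \<noteq> j \<and> i \<noteq> Suc j \<and> ?M i j"
  then obtain i j where ij: "i < n" "j < n" "i \<noteq> j" "i \<noteq> Suc j" and M: "?M i j"
    by blast
  have singular: "singular_curve n v"
    if "paths_meet (pipe n v k) (pipe n v l)" "k < 3 * n" "l < 3 * n" "k + 3 < l \<or> l + 3 < k" for k l
    using that unfolding singular_curve_def distant_def paths_meet_def by blast
  have "i < j \<or> Suc j < i"
    using ij by linarith
  with M show "singular_curve n v"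
    using singular[of "3 * i" "Suc (3 * j)"] singular[of "3 * i" "Suc (Suc (3 * j))"]
      singular[of "Suc (3 * i)" "Suc (Suc (3 * j))"] ij(1,2)
    by (elim disjE) (simp_all add: pipe_triple)
qed


section \<open>Singular codimension one cells\<close>

lemma strictly_between_irrefl: "\<not> strictly_between a a b" "\<not> strictly_between b a b"
  by (auto simp: strictly_between_def)

text \<open>
  Depending on the axis \<open>c\<close> of the coincidence, distant pipes can meet for only one pair of
  directions: y and z for \<open>c = 1\<close>, x and z for \<open>c = 2\<close>, x and y for \<open>c = 3\<close>. For the other pairs the coordinates of two
  different vertices would have to agree along an axis other than \<open>c\<close>.
\<close>

lemma singular_curve_on_wall_iff:
  assumes v: "v \<in> wall n \<sigma> c i" and s: "perm_family n \<sigma>" and i: "i \<in> {1..n - 2}"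
  shows "singular_curve n v \<longleftrightarrow>
    (\<exists>p q. {p, q} = {\<sigma> c i, \<sigma> c (Suc i)} \<and> intersection_condition \<sigma> c p q)"
proof -
  let ?pair = "\<lambda>p q. {p, q} = {\<sigma> c i, \<sigma> c (Suc i)}"
  have perm: "\<sigma> d permutes {1..<n}" for d
    using s by (simp add: perm_family_def)
  note eq_iff = wall_vertex_eq_iff[OF v s i]
  note seg_iff = wall_segment_iff[OF v s]
  have pair: "p \<in> {1..<n} \<and> q \<in> {1..<n} \<and> p \<noteq> q" if "?pair p q" for p q
  proof -
    have "\<sigma> c i \<in> {1..<n}" "\<sigma> c (Suc i) \<in> {1..<n}"
      unfolding permutes_in_image[OF perm[of c]] using i by auto
    moreover have "\<sigma> c i \<noteq> \<sigma> c (Suc i)"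
      using permutes_inj[OF perm[of c]] by (simp add: inj_eq)
    ultimately show ?thesis
      using that by (auto simp: doubleton_eq_iff)
  qed
  have "singular_curve n v \<longleftrightarrow> (\<exists>i<n. \<exists>j<n. i \<noteq> j \<and> i \<noteq> Suc j \<and>
    (paths_meet (x_pipe n v i) (y_pipe n v j) \<or>
     paths_meet (x_pipe n v i) (z_pipe n v j) \<or>
     paths_meet (y_pipe n v i) (z_pipe n v j)))" (is "_ \<longleftrightarrow> ?R")
    by (intro singular_curve_iff_mixed_pipes_meet) (auto simp: eq_iff)
  also have "?R \<longleftrightarrow> (\<exists>p q. ?pair p q \<and> intersection_condition \<sigma> c p q)"
  proof -
    consider "c = 1" | "c = 2" | "c = 3"
      using exhaust_3 by blast
    then show ?thesis
    proof cases
      case 1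
      have "?R \<longleftrightarrow> (\<exists>i<n. \<exists>j<n. i \<noteq> j \<and> i \<noteq> Suc j \<and> ?pair (Suc i) (Suc j) \<and>
          strictly_between (inv (\<sigma> 2) (Suc j)) (inv (\<sigma> 2) i) (inv (\<sigma> 2) (Suc i)) \<and>
          strictly_between (inv (\<sigma> 3) i) (inv (\<sigma> 3) j) (inv (\<sigma> 3) (Suc j)))"
        unfolding x_pipe_meets_y_pipe x_pipe_meets_z_pipe y_pipe_meets_z_pipe using 1
        by (intro ex_cong1 conj_cong refl) (auto simp: eq_iff seg_iff)
      also have "\<dots> \<longleftrightarrow> (\<exists>p q. ?pair p q \<and> intersection_condition \<sigma> c p q)"
      proof (intro iffI; elim exE conjE)
        fix p q assume pq: "?pair p q" "intersection_condition \<sigma> c p q"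
        obtain i' j' where ij: "p = Suc i'" "q = Suc j'"
          using pair[OF pq(1)] by (cases p; cases q) auto
        \<comment> \<open>The fixed x-coordinates of the pipes \<open>y\<^sub>i\<close> and \<open>z\<^sub>j\<close> belong to the vertices \<open>i + 1\<close> and \<open>j + 1\<close>;
          strictness of the betweenness conditions makes these pipes distant.\<close>
        have btw: "strictly_between (inv (\<sigma> 2) (Suc j')) (inv (\<sigma> 2) i') (inv (\<sigma> 2) (Suc i'))"
          "strictly_between (inv (\<sigma> 3) i') (inv (\<sigma> 3) j') (inv (\<sigma> 3) (Suc j'))"
          using pq(2) 1 unfolding ij by (simp_all add: intersection_condition_def Let_def)
        then have "i' \<noteq> j'" "i' \<noteq> Suc j'"
          using strictly_between_irrefl pair[OF pq(1)] unfolding ij by auto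
        moreover have "i' < n" "j' < n"
          using pair[OF pq(1)] unfolding ij by simp_all
        ultimately show "\<exists>i<n. \<exists>j<n. i \<noteq> j \<and> i \<noteq> Suc j \<and> ?pair (Suc i) (Suc j) \<and>
          strictly_between (inv (\<sigma> 2) (Suc j)) (inv (\<sigma> 2) i) (inv (\<sigma> 2) (Suc i)) \<and>
          strictly_between (inv (\<sigma> 3) i) (inv (\<sigma> 3) j) (inv (\<sigma> 3) (Suc j))"
          using pq(1) btw unfolding ij by (intro exI conjI)
      next
        fix i' j' assume "?pair (Suc i') (Suc j')"
          and "strictly_between (inv (\<sigma> 2) (Suc j')) (inv (\<sigma> 2) i') (inv (\<sigma> 2) (Suc i'))"
            "strictly_between (inv (\<sigma> 3) i') (inv (\<sigma> 3) j') (inv (\<sigma> 3) (Suc j'))"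
        then show "\<exists>p q. ?pair p q \<and> intersection_condition \<sigma> c p q"
          using 1 by (intro exI[of _ "Suc i'"] exI[of _ "Suc j'"]) (simp add: intersection_condition_def Let_def)
      qed
      finally show ?thesis .
    next
      case 2
      have "?R \<longleftrightarrow> (\<exists>i<n. \<exists>j<n. i \<noteq> j \<and> i \<noteq> Suc j \<and> ?pair i (Suc j) \<and>
          strictly_between (inv (\<sigma> 1) (Suc j)) (inv (\<sigma> 1) i) (inv (\<sigma> 1) (Suc i)) \<and>
          strictly_between (inv (\<sigma> 3) i) (inv (\<sigma> 3) j) (inv (\<sigma> 3) (Suc j)))"
        unfolding x_pipe_meets_y_pipe x_pipe_meets_z_pipe y_pipe_meets_z_pipe using 2
        by (intro ex_cong1 conj_cong refl) (auto simp: eq_iff seg_iff)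
      also have "\<dots> \<longleftrightarrow> (\<exists>p q. ?pair p q \<and> intersection_condition \<sigma> c p q)"
      proof (intro iffI; elim exE conjE)
        fix p q assume pq: "?pair p q" "intersection_condition \<sigma> c p q"
        \<comment> \<open>The fixed y-coordinates of the pipes \<open>x\<^sub>i\<close> and \<open>z\<^sub>j\<close> belong to the vertices \<open>i\<close> and \<open>j + 1\<close>.\<close>
        obtain i' j' where ij: "p = i'" "q = Suc j'"
          using pair[OF pq(1)] by (cases p; cases q) auto
        have btw: "strictly_between (inv (\<sigma> 1) (Suc j')) (inv (\<sigma> 1) i') (inv (\<sigma> 1) (Suc i'))"
          "strictly_between (inv (\<sigma> 3) i') (inv (\<sigma> 3) j') (inv (\<sigma> 3) (Suc j'))"
          using pq(2) 2 unfolding ij by (simp_all add: intersection_condition_def Let_def)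
        then have "i' \<noteq> j'" "i' \<noteq> Suc j'"
          using strictly_between_irrefl pair[OF pq(1)] unfolding ij by auto
        moreover have "i' < n" "j' < n"
          using pair[OF pq(1)] unfolding ij by simp_all
        ultimately show "\<exists>i<n. \<exists>j<n. i \<noteq> j \<and> i \<noteq> Suc j \<and> ?pair i (Suc j) \<and>
          strictly_between (inv (\<sigma> 1) (Suc j)) (inv (\<sigma> 1) i) (inv (\<sigma> 1) (Suc i)) \<and>
          strictly_between (inv (\<sigma> 3) i) (inv (\<sigma> 3) j) (inv (\<sigma> 3) (Suc j))"
          using pq(1) btw unfolding ij by (intro exI conjI)
      next
        fix i' j' assume "?pair i' (Suc j')"
          and "strictly_between (inv (\<sigma> 1) (Suc j')) (inv (\<sigma> 1) i') (inv (\<sigma> 1) (Suc i'))"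
            "strictly_between (inv (\<sigma> 3) i') (inv (\<sigma> 3) j') (inv (\<sigma> 3) (Suc j'))"
        then show "\<exists>p q. ?pair p q \<and> intersection_condition \<sigma> c p q"
          using 2 by (intro exI[of _ i'] exI[of _ "Suc j'"]) (simp add: intersection_condition_def Let_def)
      qed
      finally show ?thesis .
    next
      case 3
      have "?R \<longleftrightarrow> (\<exists>i<n. \<exists>j<n. i \<noteq> j \<and> i \<noteq> Suc j \<and> ?pair i j \<and>
          strictly_between (inv (\<sigma> 1) (Suc j)) (inv (\<sigma> 1) i) (inv (\<sigma> 1) (Suc i)) \<and>
          strictly_between (inv (\<sigma> 2) i) (inv (\<sigma> 2) j) (inv (\<sigma> 2) (Suc j)))"
        unfolding x_pipe_meets_y_pipe x_pipe_meets_z_pipe y_pipe_meets_z_pipe using 3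
        by (intro ex_cong1 conj_cong refl) (auto simp: eq_iff seg_iff)
      also have "\<dots> \<longleftrightarrow> (\<exists>p q. ?pair p q \<and> intersection_condition \<sigma> c p q)"
      proof (intro iffI; elim exE conjE)
        fix i' j' assume pq: "?pair i' j'" "intersection_condition \<sigma> c i' j'"
        have btw: "strictly_between (inv (\<sigma> 1) (Suc j')) (inv (\<sigma> 1) i') (inv (\<sigma> 1) (Suc i'))"
          "strictly_between (inv (\<sigma> 2) i') (inv (\<sigma> 2) j') (inv (\<sigma> 2) (Suc j'))"
          using pq(2) 3 by (simp_all add: intersection_condition_def Let_def)
        then have "i' \<noteq> j'" "i' \<noteq> Suc j'"
          using strictly_between_irrefl pair[OF pq(1)] by auto
        moreover have "i' < n" "j' < n"
          using pair[OF pq(1)] by simp_all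
        ultimately show "\<exists>i<n. \<exists>j<n. i \<noteq> j \<and> i \<noteq> Suc j \<and> ?pair i j \<and>
          strictly_between (inv (\<sigma> 1) (Suc j)) (inv (\<sigma> 1) i) (inv (\<sigma> 1) (Suc i)) \<and>
          strictly_between (inv (\<sigma> 2) i) (inv (\<sigma> 2) j) (inv (\<sigma> 2) (Suc j))"
          using pq(1) btw by (intro exI conjI)
      next
        fix i' j' assume "?pair i' j'"
          and "strictly_between (inv (\<sigma> 1) (Suc j')) (inv (\<sigma> 1) i') (inv (\<sigma> 1) (Suc i'))"
            "strictly_between (inv (\<sigma> 2) i') (inv (\<sigma> 2) j') (inv (\<sigma> 2) (Suc j'))"
        then show "\<exists>p q. ?pair p q \<and> intersection_condition \<sigma> c p q"
          using 3 by (intro exI[of _ i'] exI[of _ j']) (simp add: intersection_condition_def Let_def)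
      qed
      finally show ?thesis .
    qed
  qed
  finally show ?thesis .
qed


section \<open>The complex of singular curves\<close>

lemma produces_intersection_transpose_iff:
  assumes "a \<noteq> b"
  shows "produces_intersection \<sigma> c (Transposition.transpose a b) \<longleftrightarrow>
    (\<exists>p q. {p, q} = {a, b} \<and> intersection_condition \<sigma> c p q)"
proof -
  have "produces_intersection \<sigma> c (Transposition.transpose a b) \<longleftrightarrow>
      (\<exists>p q. p \<noteq> q \<and> {a, b} = {p, q} \<and> (intersection_condition \<sigma> c p q \<or> intersection_condition \<sigma> c q p))"
    unfolding produces_intersection_def transpose_eq_iff_doubleton[OF assms] ..
  also have "\<dots> \<longleftrightarrow> (\<exists>p q. {p, q} = {a, b} \<and> intersection_condition \<sigma> c p q)"
    using assms by (auto simp: doubleton_eq_iff)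
  finally show ?thesis .
qed

lemma intersection_cells_eq_walls:
  "intersection_cells n = {wall n \<sigma> c i | \<sigma> c i. perm_family n \<sigma> \<and> i \<in> {1..n - 2} \<and>
    (\<exists>p q. {p, q} = {\<sigma> c i, \<sigma> c (Suc i)} \<and> intersection_condition \<sigma> c p q)}" (is "_ = ?W")
proof -
  let ?\<tau> = "\<lambda>\<sigma> c i. Transposition.transpose (\<sigma> c i) (\<sigma> c (i + 1))"
  have ne: "\<sigma> c i \<noteq> \<sigma> c (Suc i)" if "perm_family n \<sigma>" for \<sigma> c i
    using that permutes_inj[of "\<sigma> c" "{1..<n}"] by (auto simp: perm_family_def inj_eq)
  have "intersection_cells n = {codim_one_cell n \<sigma> c (?\<tau> \<sigma> c i) | \<sigma> c i.
      perm_family n \<sigma> \<and> i \<in> {1..n - 2} \<and> produces_intersection \<sigma> c (?\<tau> \<sigma> c i)}"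
    unfolding intersection_cells_def appears_def by blast
  also have "\<dots> = ?W"
  proof -
    have "codim_one_cell n \<sigma> c (?\<tau> \<sigma> c i) = wall n \<sigma> c i"
      "produces_intersection \<sigma> c (?\<tau> \<sigma> c i) \<longleftrightarrow>
        (\<exists>p q. {p, q} = {\<sigma> c i, \<sigma> c (Suc i)} \<and> intersection_condition \<sigma> c p q)"
      if "perm_family n \<sigma>" "i \<in> {1..n - 2}" for \<sigma> c i
      using that codim_one_cell_eq_wall[of \<sigma> c n i] ne[of \<sigma> c i]
      by (simp_all add: perm_family_def produces_intersection_transpose_iff)
    then show ?thesis
      by (intro Collect_cong ex_cong1 iffI; elim conjE; simp only: simp_thms)
  qed
  finally show ?thesis .
qed

lemma codim_one_cell_singular_iff:
  assumes "e \<in> cells_of_codim n 1"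
  shows "e \<subseteq> singular_space n \<longleftrightarrow> e \<in> intersection_cells n"
proof
  obtain \<sigma> c i where e: "e = wall n \<sigma> c i" and s: "perm_family n \<sigma>" and i: "i \<in> {1..n - 2}"
    using assms unfolding cells_of_codim_one by blast
  assume "e \<subseteq> singular_space n"
  moreover obtain v where v: "v \<in> e"
    using cell_nonempty[OF s] e by blast
  ultimately have "singular_curve n v"
    by (auto simp: singular_space_def)
  then show "e \<in> intersection_cells n"
    using singular_curve_on_wall_iff[OF v[unfolded e] s i] e s i
    unfolding intersection_cells_eq_walls by blast
next
  assume "e \<in> intersection_cells n"
  then obtain \<sigma> c i where e: "e = wall n \<sigma> c i" and s: "perm_family n \<sigma>" and i: "i \<in> {1..n - 2}"
    and "\<exists>p q. {p, q} = {\<sigma> c i, \<sigma> c (Suc i)} \<and> intersection_condition \<sigma> c p q"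
    unfolding intersection_cells_eq_walls by blast
  then have "singular_curve n v" if "v \<in> e" for v
    using singular_curve_on_wall_iff[OF that[unfolded e] s i] by simp
  then show "e \<subseteq> singular_space n"
    using cell_subset unfolding e singular_space_def by blast
qed

lemma continuous_map_plumbers_coordinate:
  assumes "a \<in> {1..<n}"
  shows "continuous_map (plumbers_topology n) euclideanreal (\<lambda>v. v a $ c)"
proof -
  have "continuous_map (plumbers_topology n) (top_of_set (box 0 1)) (\<lambda>v. v a)"
    unfolding plumbers_topology_def using assms by (rule continuous_map_product_projection)
  moreover have "continuous_map (top_of_set (box 0 1)) euclideanreal (\<lambda>x :: real ^ 3. x $ c)"
    unfolding continuous_map_iff_continuous by (intro continuous_intros)
  ultimately show ?thesis
    by (rule continuous_map_compose[unfolded o_def])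
qed

text \<open>Weak inequalities between coordinates define closed sets, so they pass to closures.\<close>

lemma closure_of_coordinate_le:
  assumes v: "v \<in> plumbers_topology n closure_of S" and S: "S \<subseteq> plumbers_space n"
    and ab: "a \<in> {1..<n}" "b \<in> {1..<n}" and le: "\<And>w. w \<in> S \<Longrightarrow> w a $ c \<le> w b $ c"
  shows "v a $ c \<le> v b $ c"
proof -
  let ?D = "{w \<in> topspace (plumbers_topology n). w a $ c - w b $ c \<in> {..0}}"
  have "closedin (plumbers_topology n) ?D"
    using ab by (intro closedin_continuous_map_preimage[of _ euclideanreal] continuous_map_diff
        continuous_map_plumbers_coordinate) auto
  moreover have "S \<subseteq> ?D"
    using S le by (auto simp: topspace_plumbers_topology)
  ultimately have "plumbers_topology n closure_of S \<subseteq> ?D"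
    by (rule closure_of_minimal[rotated])
  then show ?thesis
    using v by auto
qed

text \<open>
  The equality that defines the first cell persists at \<open>v\<close> and uses up the only coincidence that the
  second cell allows there; all other inequalities, which hold weakly in the closure, are therefore
  strict at \<open>v\<close>.
\<close>

lemma in_wall_if_in_closure_of_wall:
  assumes cl: "v \<in> plumbers_topology n closure_of (wall n \<sigma> c i)"
    and s: "perm_family n \<sigma>" and i: "i \<in> {1..n - 2}"
    and v: "v \<in> wall n \<sigma>' c' i'" and s': "perm_family n \<sigma>'" and i': "i' \<in> {1..n - 2}"
  shows "v \<in> wall n \<sigma> c i"
proof -
  have perm: "\<sigma> d permutes {1..<n}" for d
    using s by (simp add: perm_family_def)
  have in_range: "\<sigma> d j \<in> {1..<n}" "\<sigma> d (Suc j) \<in> {1..<n}" if "j \<in> {1..n - 2}" for d j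
    unfolding permutes_in_image[OF perm[of d]] using that by auto
  have ge: "v (\<sigma> d j) $ d \<le> v (\<sigma> d (Suc j)) $ d" if j: "j \<in> {1..n - 2}" for d j
  proof (rule closure_of_coordinate_le[OF cl cell_subset in_range[OF j]])
    fix w assume "w \<in> wall n \<sigma> c i"
    then have "if j \<in> (if d = c then {i} else {}) then w (\<sigma> d j) $ d = w (\<sigma> d (j + 1)) $ d
        else w (\<sigma> d j) $ d < w (\<sigma> d (j + 1)) $ d"
      using j unfolding cell_def by blast
    then show "w (\<sigma> d j) $ d \<le> w (\<sigma> d (Suc j)) $ d"
      by (simp split: if_splits)
  qed
  have "v (\<sigma> c (Suc i)) $ c \<le> v (\<sigma> c i) $ c"
  proof (rule closure_of_coordinate_le[OF cl cell_subset in_range(2)[OF i] in_range(1)[OF i]])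
    fix w assume "w \<in> wall n \<sigma> c i"
    then show "w (\<sigma> c (Suc i)) $ c \<le> w (\<sigma> c i) $ c"
      using i by (auto simp: cell_def)
  qed
  then have eq: "v (\<sigma> c i) $ c = v (\<sigma> c (Suc i)) $ c"
    using ge[OF i, of c] by simp
  have coincide: "d = c' \<and> {\<sigma> d j, \<sigma> d (Suc j)} = {\<sigma>' c' i', \<sigma>' c' (Suc i')}"
    if "j \<in> {1..n - 2}" "v (\<sigma> d j) $ d = v (\<sigma> d (Suc j)) $ d" for d j
  proof -
    have "\<sigma> d j \<noteq> \<sigma> d (Suc j)"
      using permutes_inj[OF perm] by (simp add: inj_eq)
    moreover have "vertex n v (\<sigma> d j) $ d = vertex n v (\<sigma> d (Suc j)) $ d"
      using in_range[OF that(1), of d] that(2) by (simp add: vertex_def)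
    moreover have "\<sigma> d j \<le> n" "\<sigma> d (Suc j) \<le> n"
      using in_range[OF that(1), of d] by simp_all
    ultimately show ?thesis
      using wall_vertex_eq_iff[OF v s' i', of "\<sigma> d j" "\<sigma> d (Suc j)" d] by blast
  qed
  have "if j \<in> (if d = c then {i} else {}) then v (\<sigma> d j) $ d = v (\<sigma> d (j + 1)) $ d
      else v (\<sigma> d j) $ d < v (\<sigma> d (j + 1)) $ d" if j: "j \<in> {1..n - 2}" for d j
  proof (cases "d = c \<and> j = i")
    case True
    then show ?thesis
      using eq by simp
  next
    case False
    have "v (\<sigma> d j) $ d \<noteq> v (\<sigma> d (Suc j)) $ d"
    proof
      assume "v (\<sigma> d j) $ d = v (\<sigma> d (Suc j)) $ d"
      then have "d = c" "{\<sigma> c j, \<sigma> c (Suc j)} = {\<sigma> c i, \<sigma> c (Suc i)}"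
        using coincide[OF j, of d] coincide[OF i eq] by auto
      then show False
        using False permuted_pair_eq_iff[OF perm] by blast
    qed
    then show ?thesis
      using False ge[OF j, of d] by auto
  qed
  then show ?thesis
    using v unfolding cell_def by blast
qed

theorem corollary2p20:
  fixes n :: nat
  assumes "n \<ge> 3"
  shows "singular_complex n = generated_complex n (intersection_cells n)
    \<and> singular_complex n \<inter> cells_of_dim n (3 * n - 4) = intersection_cells n
    \<and> (\<forall>e \<in> cells_of_codim n 1. e \<subseteq> singular_space n \<longleftrightarrow> e \<in> intersection_cells n)"
proof -
  have subset: "intersection_cells n \<subseteq> cells_of_codim n 1"
    unfolding intersection_cells_eq_walls cells_of_codim_one by blast
  have "{e \<in> cells_of_codim n 1. e \<subseteq> singular_space n} = intersection_cells n"
    using codim_one_cell_singular_iff subset by blast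
  then have complex: "singular_complex n = generated_complex n (intersection_cells n)"
    by (simp add: singular_complex_def)
  have dim: "cells_of_dim n (3 * n - 4) = cells_of_codim n 1"
  proof -
    have "3 * n - 4 + k = 3 * n - 3 \<longleftrightarrow> k = 1" for k
      using assms by linarith
    then show ?thesis
      by (simp add: cells_of_dim_def)
  qed
  have "generated_complex n (intersection_cells n) \<inter> cells_of_codim n 1 = intersection_cells n"
  proof (intro equalityI subsetI)
    fix e assume "e \<in> generated_complex n (intersection_cells n) \<inter> cells_of_codim n 1"
    then obtain g where e: "e \<in> cells_of_codim n 1" and g: "g \<in> intersection_cells n"
      and cl: "e \<subseteq> plumbers_topology n closure_of g"
      by (auto simp: generated_complex_def)
    obtain \<sigma> c i where e_eq: "e = wall n \<sigma> c i" and s: "perm_family n \<sigma>" and i: "i \<in> {1..n - 2}"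
      using e unfolding cells_of_codim_one by blast
    obtain \<rho> d j where g_eq: "g = wall n \<rho> d j" and r: "perm_family n \<rho>" and j: "j \<in> {1..n - 2}"
      using g subset unfolding cells_of_codim_one by blast
    obtain v where v: "v \<in> e"
      using cell_nonempty[OF s] e_eq by blast
    then have "v \<in> g"
      using in_wall_if_in_closure_of_wall[of v n \<rho> d j \<sigma> c i] cl r j s i unfolding e_eq g_eq by blast
    then have "e = g"
      using v r j s i unfolding e_eq g_eq by (intro cells_meeting_equal) auto
    then show "e \<in> intersection_cells n"
      using g by simp
  next
    fix e assume e: "e \<in> intersection_cells n"
    then have codim: "e \<in> cells_of_codim n 1"
      using subset by blast
    then have "e \<subseteq> topspace (plumbers_topology n)"
      using cell_subset unfolding topspace_plumbers_topology cells_of_codim_one by blast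
    then have "e \<subseteq> plumbers_topology n closure_of e"
      by (rule closure_of_subset)
    then show "e \<in> generated_complex n (intersection_cells n) \<inter> cells_of_codim n 1"
      using e codim by (auto simp: generated_complex_def cells_def)
  qed
  then show ?thesis
    using complex dim codim_one_cell_singular_iff by simp
qed

end
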